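(* The converse of the implication "if $\phi\in H^\infty(\mathbb{D})$, $f\in H^2(\mathbb{D})$ and $\{\phi^n f\}_{n=0}^\infty$ is a frame for $H^2(\mathbb{D})$, then $\phi$ is an inner function" is not true in general: $\phi$ being inner does not guarantee that $\{\phi^n f\}_{n=0}^\infty$ is a frame for $H^2(\mathbb{D})$. In particular, for every integer $m\ge 2$ and the inner function $\phi(z)=z^m$, there is no $f\in H^2(\mathbb{D})$ such that $\{\phi^n f\}_{n=0}^\infty=\{z^{mn}f\}_{n=0}^\infty$ is a frame for $H^2(\mathbb{D})$.
   Context: $\mathbb{D}=\{z\in\mathbb{C}:|z|<1\}$ is the open unit disk and $\mathbb{T}$ the unit circle. $H^\infty(\mathbb{D})$ is the space of bounded holomorphic functions on $\mathbb{D}$. $H^2(\mathbb{D})$ is the Hardy space of holomorphic functions $f(z)=\sum_{n\ge 0}a_nz^n$ on $\mathbb{D}$ with $\|f\|_2^2=\sum_{n\ge0}|a_n|^2<\infty$; it is a Hilbert space with inner product $\langle f,g\rangle=\int_0^{2\pi} f(e^{i\theta})\overline{g(e^{i\theta})}\,\frac{d\theta}{2\pi}$, computed from radial boundary values. A function $\phi\in H^\infty(\mathbb{D})$ is inner if its radial boundary values satisfy $|\phi(e^{i\theta})|=1$ a.e. on $\mathbb{T}$. The sequence $\{\phi^n f\}_{n=0}^\infty\subset H^2(\mathbb{D})$ is a frame for $H^2(\mathbb{D})$ if there exist constants $A,B>0$ such that $A\|g\|_2^2\le\sum_{n=0}^\infty|\langle g,\phi^n f\rangle|^2\le B\|g\|_2^2$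 for all $g\in H^2(\mathbb{D})$. *)

theory Defs
  imports "HOL-Complex_Analysis.Complex_Analysis"
begin

text \<open>Functions on the open unit disk are represented by total functions on the complex numbers;
  none of the definitions below depends on the values outside the disk.\<close>

definition hardy_inf :: "(complex \<Rightarrow> complex) set" where
  "hardy_inf = {\<phi>. \<phi> holomorphic_on ball 0 1 \<and> bounded (\<phi> ` ball 0 1)}"

definition taylor_coeff :: "(complex \<Rightarrow> complex) \<Rightarrow> nat \<Rightarrow> complex" where
  "taylor_coeff f n = fps_nth (fps_expansion f 0) n"

definition hardy2 :: "(complex \<Rightarrow> complex) set" where
  "hardy2 = {f. f holomorphic_on ball 0 1 \<and> summable (\<lambda>n. (cmod (taylor_coeff f n))\<^sup>2)}"

definition hardy2_norm :: "(complex \<Rightarrow> complex) \<Rightarrow> real" where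
  "hardy2_norm f = sqrt (\<Sum>n. (cmod (taylor_coeff f n))\<^sup>2)"

definition has_radial_limit :: "(complex \<Rightarrow> complex) \<Rightarrow> real \<Rightarrow> complex \<Rightarrow> bool" where
  "has_radial_limit f \<theta> l \<longleftrightarrow> ((\<lambda>r. f (of_real r * cis \<theta>)) \<longlongrightarrow> l) (at_left (1::real))"

text \<open>The radial boundary value is an unspecified constant at angles where the radial limit does not
  exist; for functions in the Hardy spaces these angles form a null set (Fatou).\<close>

definition radial_value :: "(complex \<Rightarrow> complex) \<Rightarrow> real \<Rightarrow> complex" where
  "radial_value f \<theta> = (THE l. has_radial_limit f \<theta> l)"

definition hardy2_inner :: "(complex \<Rightarrow> complex) \<Rightarrow> (complex \<Rightarrow> complex) \<Rightarrow> complex" where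
  "hardy2_inner f g =
     (LINT \<theta>|lebesgue_on {0..2 * pi}. radial_value f \<theta> * cnj (radial_value g \<theta>)) / of_real (2 * pi)"

definition inner_function :: "(complex \<Rightarrow> complex) \<Rightarrow> bool" where
  "inner_function \<phi> \<longleftrightarrow> \<phi> \<in> hardy_inf \<and>
     (AE \<theta> in lebesgue_on {0..2 * pi}. \<exists>l. has_radial_limit \<phi> \<theta> l \<and> cmod l = 1)"

text \<open>The sequence \<open>\<phi>\<^sup>n f\<close> is a frame for the Hardy space. Summability is required explicitly because
  \<open>suminf\<close> of a divergent series is a junk value, whereas a divergent sum of squares violates the
  upper frame bound.\<close>

definition orbit_frame :: "(complex \<Rightarrow> complex) \<Rightarrow> (complex \<Rightarrow> complex) \<Rightarrow> bool" where
  "orbit_frame \<phi> f \<longleftrightarrow>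
     (\<exists>A>0. \<exists>B>0. \<forall>g\<in>hardy2.
        summable (\<lambda>n. (cmod (hardy2_inner g (\<lambda>z. \<phi> z ^ n * f z)))\<^sup>2) \<and>
        A * (hardy2_norm g)\<^sup>2 \<le> (\<Sum>n. (cmod (hardy2_inner g (\<lambda>z. \<phi> z ^ n * f z)))\<^sup>2) \<and>
        (\<Sum>n. (cmod (hardy2_inner g (\<lambda>z. \<phi> z ^ n * f z)))\<^sup>2) \<le> B * (hardy2_norm g)\<^sup>2)"

end

theory Submission
  imports Defs
begin

text \<open>Fix \<open>m \<ge> 2\<close>. Multiplication by \<open>z^m\<close> is a shift of multiplicity \<open>m\<close>, so a single function \<open>f\<close> has
  too few translates \<open>z^(m n) f\<close> to control the whole Hardy space. Quantitatively, let \<open>a n j\<close> be the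
  inner product of \<open>z^j\<close> with \<open>z^(m n) f\<close>. Since \<open>|z| = 1\<close> on the circle,
  \<open>a (n + 1) (j + m) = a n j\<close>. The frame coefficients of a polynomial \<open>p (z^m) + z q (z^m)\<close> are
  therefore the convolution expression \<open>p * u + q * v\<close>, where the sequences \<open>u\<close> and \<open>v\<close> on the
  integers collect the values of \<open>a\<close> at \<open>j = m k\<close> and \<open>j = m k + 1\<close>. The frame inequality says
  that this expression is comparable in norm to \<open>(p, q)\<close>. But it vanishes for \<open>p = v\<close>, \<open>q = - u\<close>,
  because convolution commutes. Approximating this pair by its truncations
  contradicts the lower bound (\<open>translates_of_two_sequences_not_bounded_below\<close>, transferred to
  the coefficients \<open>a\<close> in \<open>shift_invariant_coefficients_not_bounded_below\<close>).

  The argument treats \<open>f\<close> only through its radial values. On the measurable set of angles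
  at which \<open>f\<close> has no radial limit, the radial value of every \<open>z^(m n) f\<close> is one and the same constant.
  This set contributes to \<open>a (n + 1) (j + m) - a n j\<close> a term that does not depend on \<open>n\<close>; as the frame
  coefficients tend to \<open>0\<close>, this term is \<open>0\<close>, and the shift invariance holds exactly
  (\<open>z_power_orbit_not_frame\<close>). All of this applies to \<open>z^2\<close>, which gives the two negated
  general claims.\<close>

section \<open>Square-summable sequences on the integers\<close>

lemma finite_int_subset_symmetric_interval:
  assumes "finite X"
  obtains K :: nat where "X \<subseteq> {-int K..int K}"
proof -
  have "x \<in> {-int (nat (\<Sum>x\<in>X. \<bar>x\<bar>))..int (nat (\<Sum>x\<in>X. \<bar>x\<bar>))}" if "x \<in> X" for x
  proof -
    have "\<bar>x\<bar> \<le> (\<Sum>x\<in>X. \<bar>x\<bar>)"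
      using assms that by (intro member_le_sum) auto
    then show ?thesis by auto
  qed
  then show ?thesis using that by blast
qed

lemma has_sum_imp_symmetric_partial_sums:
  fixes h :: "int \<Rightarrow> 'a::{comm_monoid_add,topological_space}"
  assumes "(h has_sum s) UNIV"
  shows "(\<lambda>K. \<Sum>j=-int K..int K. h j) \<longlonglongrightarrow> s"
proof -
  have "filterlim (\<lambda>K. {-int K..int K}) (finite_subsets_at_top UNIV) sequentially"
    unfolding filterlim_finite_subsets_at_top
  proof safe
    fix X :: "int set" assume "finite X"
    then obtain K :: nat where K: "X \<subseteq> {-int K..int K}"
      by (rule finite_int_subset_symmetric_interval)
    show "\<forall>\<^sub>F K in sequentially. finite {-int K..int K} \<and> X \<subseteq> {-int K..int K} \<and> {-int K..int K} \<subseteq> UNIV"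
      using eventually_ge_at_top[of K]
      by eventually_elim (use K in auto)
  qed
  from filterlim_compose[OF assms[unfolded has_sum_def] this] show ?thesis .
qed

lemma summable_on_of_bounded_symmetric_sums:
  fixes h :: "int \<Rightarrow> real"
  assumes nonneg: "\<And>j. 0 \<le> h j" and bound: "\<And>K::nat. (\<Sum>j=-int K..int K. h j) \<le> C"
  shows "h summable_on UNIV"
proof (rule nonneg_bdd_above_summable_on)
  show "bdd_above (sum h ` {F. F \<subseteq> UNIV \<and> finite F})"
  proof (rule bdd_aboveI2[where M = C])
    fix F assume "F \<in> {F. F \<subseteq> (UNIV :: int set) \<and> finite F}"
    then obtain K :: nat where "F \<subseteq> {-int K..int K}"
      using finite_int_subset_symmetric_interval by blast
    then have "sum h F \<le> (\<Sum>j=-int K..int K. h j)"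
      by (intro sum_mono2) (auto simp: nonneg)
    then show "sum h F \<le> C" using bound[of K] by linarith
  qed
qed (use nonneg in auto)

lemma convolution_summable_on:
  fixes u v :: "int \<Rightarrow> complex"
  assumes "(\<lambda>j. (cmod (u j))\<^sup>2) summable_on UNIV" "(\<lambda>j. (cmod (v j))\<^sup>2) summable_on UNIV"
  shows "(\<lambda>j. u j * v (n - j)) summable_on UNIV"
proof -
  have "bij_betw (\<lambda>j. n - j) UNIV UNIV" by (rule bij_betwI[of _ _ _ "\<lambda>j. n - j"]) auto
  from summable_on_reindex_bij_betw[OF this, of "\<lambda>j. (cmod (v j))\<^sup>2"] assms(2)
  have "(\<lambda>j. (cmod (v (n - j)))\<^sup>2) summable_on UNIV" by simp
  with assms(1) have s: "(\<lambda>j. (cmod (u j))\<^sup>2 + (cmod (v (n - j)))\<^sup>2) summable_on UNIV"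
    by (rule summable_on_add)
  show ?thesis
  proof (rule abs_summable_summable, rule summable_on_comparison_test[OF s])
    fix j :: int
    have "2 * (cmod (u j) * cmod (v (n - j))) \<le> (cmod (u j))\<^sup>2 + (cmod (v (n - j)))\<^sup>2"
      using sum_squares_bound[of "cmod (u j)" "cmod (v (n-j))"] by (simp add: mult.assoc)
    moreover have "0 \<le> cmod (u j) * cmod (v (n - j))" by simp
    ultimately show "cmod (u j * v (n - j)) \<le> (cmod (u j))\<^sup>2 + (cmod (v (n - j)))\<^sup>2"
      unfolding norm_mult by linarith
  qed simp
qed

text \<open>The pair \<open>(v, - u)\<close> is the syzygy of \<open>(u, v)\<close>: formally \<open>v * u - u * v = 0\<close> as convolutions.
  Truncating only the first factors breaks the symmetry, but entrywise it is restored in the limit,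
  because the substitution \<open>k \<mapsto> n - k\<close> exchanges the two absolutely convergent series.\<close>

lemma truncated_commutator_tendsto_0:
  fixes u v :: "int \<Rightarrow> complex"
  assumes "(\<lambda>j. (cmod (u j))\<^sup>2) summable_on UNIV" "(\<lambda>j. (cmod (v j))\<^sup>2) summable_on UNIV"
  shows "(\<lambda>K. \<Sum>k=-int K..int K. v k * u (n - k) - u k * v (n - k)) \<longlonglongrightarrow> 0"
proof -
  have bij: "bij_betw (\<lambda>j. n - j) UNIV UNIV" by (rule bij_betwI[of _ _ _ "\<lambda>j. n - j"]) auto
  from convolution_summable_on[OF assms(2,1), of n] obtain s
    where s: "((\<lambda>k. v k * u (n - k)) has_sum s) UNIV" by (auto simp: summable_on_def)
  with has_sum_reindex_bij_betw[OF bij, of "\<lambda>k. v k * u (n - k)" s]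
  have s': "((\<lambda>k. u k * v (n - k)) has_sum s) UNIV" by (simp add: mult.commute)
  show ?thesis
    using tendsto_diff[OF has_sum_imp_symmetric_partial_sums[OF s] has_sum_imp_symmetric_partial_sums[OF s']]
    by (simp add: sum_subtractf)
qed

text \<open>The synthesis operator of the family of all integer translates of \<open>u\<close> and \<open>v\<close>, applied to the
  coefficients \<open>(p, q)\<close> cut off to the window \<open>[-K, K]\<close>; \<open>coeff_energy\<close> is the squared norm of
  these coefficients.\<close>

definition translate_comb ::
  "(int \<Rightarrow> complex) \<Rightarrow> (int \<Rightarrow> complex) \<Rightarrow> nat \<Rightarrow> (int \<Rightarrow> complex) \<Rightarrow> (int \<Rightarrow> complex) \<Rightarrow> int \<Rightarrow> complex" where
  "translate_comb u v K p q n = (\<Sum>k=-int K..int K. p k * u (n - k) + q k * v (n - k))"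

definition coeff_energy :: "nat \<Rightarrow> (int \<Rightarrow> complex) \<Rightarrow> (int \<Rightarrow> complex) \<Rightarrow> real" where
  "coeff_energy K p q = (\<Sum>k=-int K..int K. (cmod (p k))\<^sup>2 + (cmod (q k))\<^sup>2)"

text \<open>The translates of one sequence may form a Riesz basis of the square-summable sequences on the
  integers, which leaves no room for the translates of a second one: a pair of multipliers
  \<open>(p, q) \<mapsto> p * u + q * v\<close> has the kernel element \<open>(v, - u)\<close>. That element is not finitely supported,
  so its truncations are used. Their images \<open>e K\<close> tend to \<open>0\<close> entrywise, and the upper bound
  turns the square-summability of \<open>u\<close> and \<open>v\<close> into the Cauchy property of \<open>e\<close> in norm, so they tend
  to \<open>0\<close> in norm. The lower bound then forces \<open>u = v = 0\<close>, which it excludes as well.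

  Both bounds are phrased through partial sums over \<open>[-M, M]\<close>, so that they make sense for all
  finitely supported \<open>p\<close> and \<open>q\<close> before anything is known about \<open>u\<close> and \<open>v\<close>.\<close>

lemma translates_of_two_sequences_not_bounded_below:
  fixes u v :: "int \<Rightarrow> complex"
  assumes upper: "\<And>K (M::nat) p q.
      (\<Sum>n=-int M..int M. (cmod (translate_comb u v K p q n))\<^sup>2) \<le> B * coeff_energy K p q"
    and lower: "\<And>K p q C. (\<And>M::nat. (\<Sum>n=-int M..int M. (cmod (translate_comb u v K p q n))\<^sup>2) \<le> C)
      \<Longrightarrow> A * coeff_energy K p q \<le> C"
  shows "A \<le> 0"
proof (rule ccontr)
  assume "\<not> A \<le> 0"
  then have A: "A > 0" by simp
  have u_bound: "(\<Sum>n=-int M..int M. (cmod (u n))\<^sup>2) \<le> B" for M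
    using upper[where K = 0 and p = "\<lambda>_. 1" and q = "\<lambda>_. 0" and M = M]
    by (simp add: translate_comb_def coeff_energy_def)
  have v_bound: "(\<Sum>n=-int M..int M. (cmod (v n))\<^sup>2) \<le> B" for M
    using upper[where K = 0 and p = "\<lambda>_. 0" and q = "\<lambda>_. 1" and M = M]
    by (simp add: translate_comb_def coeff_energy_def)
  have u_l2: "(\<lambda>n. (cmod (u n))\<^sup>2) summable_on UNIV"
    by (rule summable_on_of_bounded_symmetric_sums[OF _ u_bound]) simp
  have v_l2: "(\<lambda>n. (cmod (v n))\<^sup>2) summable_on UNIV"
    by (rule summable_on_of_bounded_symmetric_sums[OF _ v_bound]) simp
  define s where "s K = coeff_energy K v (\<lambda>k. - u k)" for K
  define e where "e K = translate_comb u v K v (\<lambda>k. - u k)" for K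
  have "(\<lambda>n. (cmod (v n))\<^sup>2 + (cmod (u n))\<^sup>2) summable_on UNIV"
    by (rule summable_on_add[OF v_l2 u_l2])
  then obtain S where "((\<lambda>n. (cmod (v n))\<^sup>2 + (cmod (u n))\<^sup>2) has_sum S) UNIV"
    by (auto simp: summable_on_def)
  from has_sum_imp_symmetric_partial_sums[OF this] have s_lim: "s \<longlonglongrightarrow> S"
    by (simp add: s_def[abs_def] coeff_energy_def)
  have s_mono: "s K \<le> s L" if "K \<le> L" for K L
    unfolding s_def coeff_energy_def using that by (intro sum_mono2) auto
  have s_le: "s K \<le> S" for K
    using s_mono s_lim by (intro incseq_le) (auto simp: incseq_def)
  have e_lim: "(\<lambda>K. e K n) \<longlonglongrightarrow> 0" for n
    using truncated_commutator_tendsto_0[OF u_l2 v_l2, of n]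
    by (simp add: e_def translate_comb_def)
  \<comment> \<open>By linearity the difference of two truncations is the image of the coefficients between the windows.\<close>
  have block: "(\<Sum>n=-int M..int M. (cmod (e L n - e K n))\<^sup>2) \<le> B * (s L - s K)"
    if KL: "K \<le> L" for K L M
  proof -
    define p q where "p k = (if k \<in> {-int K..int K} then 0 else v k)"
      and "q k = (if k \<in> {-int K..int K} then 0 else - u k)" for k
    have split: "sum h {-int L..int L} - sum h {-int K..int K} =
        (\<Sum>k=-int L..int L. if k \<in> {-int K..int K} then 0 else h k)" for h :: "int \<Rightarrow> 'b::ab_group_add"
    proof -
      have "sum h {-int K..int K} = (\<Sum>k=-int L..int L. if k \<in> {-int K..int K} then h k else 0)"
        using KL by (intro sum.mono_neutral_cong_left) auto
      then show ?thesis
        by (simp only: sum_subtractf[symmetric]) (auto intro!: sum.cong)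
    qed
    have "e L n - e K n = translate_comb u v L p q n" for n
      unfolding e_def translate_comb_def split by (auto intro!: sum.cong simp: p_def q_def)
    moreover have "s L - s K = coeff_energy L p q"
      unfolding s_def coeff_energy_def split by (auto intro!: sum.cong simp: p_def q_def)
    ultimately show ?thesis using upper[where K = L and p = p and q = q and M = M] by simp
  qed
  \<comment> \<open>Letting \<open>L \<rightarrow> \<infinity>\<close> in the previous bound removes \<open>e L\<close> and leaves the energy of the tail.\<close>
  have "A * s K \<le> B * (S - s K)" for K
  proof -
    have "(\<Sum>n=-int M..int M. (cmod (e K n))\<^sup>2) \<le> B * (S - s K)" for M
    proof (rule LIMSEQ_le)
      show "(\<lambda>L. \<Sum>n=-int M..int M. (cmod (e L n - e K n))\<^sup>2)
          \<longlonglongrightarrow> (\<Sum>n=-int M..int M. (cmod (e K n))\<^sup>2)"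
      proof (rule tendsto_sum)
        fix n
        have "(\<lambda>L. (cmod (e L n - e K n))\<^sup>2) \<longlonglongrightarrow> (cmod (0 - e K n))\<^sup>2"
          by (intro tendsto_intros e_lim)
        then show "(\<lambda>L. (cmod (e L n - e K n))\<^sup>2) \<longlonglongrightarrow> (cmod (e K n))\<^sup>2" by simp
      qed
      show "(\<lambda>L. B * (s L - s K)) \<longlonglongrightarrow> B * (S - s K)"
        by (intro tendsto_intros s_lim)
    qed (use block in blast)
    then show ?thesis
      unfolding s_def e_def by (rule lower)
  qed
  moreover have "(\<lambda>K. A * s K) \<longlonglongrightarrow> A * S" "(\<lambda>K. B * (S - s K)) \<longlonglongrightarrow> B * (S - S)"
    by (intro tendsto_intros s_lim)+
  ultimately have "A * S \<le> B * (S - S)"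
    by (intro LIMSEQ_le) auto
  then have "S \<le> 0" using A by (simp add: mult_le_0_iff)
  \<comment> \<open>The coefficients \<open>p = 1\<close>, \<open>q = 0\<close> at the origin reproduce \<open>u\<close>, whose energy is at most \<open>S\<close>.\<close>
  have "A * coeff_energy 0 (\<lambda>_. 1) (\<lambda>_. 0) \<le> S"
  proof (rule lower)
    fix M :: nat
    have "(\<Sum>n=-int M..int M. (cmod (translate_comb u v 0 (\<lambda>_. 1) (\<lambda>_. 0) n))\<^sup>2) \<le> s M"
      by (auto simp: translate_comb_def s_def coeff_energy_def intro!: sum_mono)
    then show "(\<Sum>n=-int M..int M. (cmod (translate_comb u v 0 (\<lambda>_. 1) (\<lambda>_. 0) n))\<^sup>2) \<le> S"
      using s_le[of M] by linarith
  qed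
  with \<open>S \<le> 0\<close> A show False by (simp add: coeff_energy_def)
qed

section \<open>Shift-invariant coefficients\<close>

text \<open>Here \<open>a n j\<close> plays the role of the \<open>n\<close>-th frame coefficient of the \<open>j\<close>-th monomial. By shift
  invariance, \<open>a n (m * k + l)\<close> depends only on \<open>l\<close> and on the integer \<open>n - k\<close>, so the residue
  classes \<open>l = 0\<close> and \<open>l = 1\<close> yield two sequences on the integers whose translates occur as
  coefficient sequences. The indices \<open>n\<close> and \<open>j\<close> are only natural numbers, but multiplying a
  polynomial by \<open>z^(m r)\<close> delays its coefficient sequence by \<open>r\<close>, and for large \<open>r\<close> every finite
  window of the integers becomes visible.\<close>

lemma shift_invariant_coefficients_not_bounded_below:
  fixes a :: "nat \<Rightarrow> nat \<Rightarrow> complex"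
  assumes m: "m \<ge> 2"
    and shift: "\<And>n j. a (Suc n) (j + m) = a n j"
    and summable: "\<And>J c. finite J \<Longrightarrow> summable (\<lambda>n. (cmod (\<Sum>j\<in>J. c j * a n j))\<^sup>2)"
    and lower: "\<And>J c. finite J \<Longrightarrow> A * (\<Sum>j\<in>J. (cmod (c j))\<^sup>2) \<le> (\<Sum>n. (cmod (\<Sum>j\<in>J. c j * a n j))\<^sup>2)"
    and upper: "\<And>J c. finite J \<Longrightarrow> (\<Sum>n. (cmod (\<Sum>j\<in>J. c j * a n j))\<^sup>2) \<le> B * (\<Sum>j\<in>J. (cmod (c j))\<^sup>2)"
  shows "A \<le> 0"
proof -
  have shift_iter: "a (n + k) (j + m * k) = a n j" for n k j
  proof (induction k)
    case (Suc k)
    then show ?case using shift[of "n + k" "j + m * k"] by (simp add: algebra_simps)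
  qed simp
  \<comment> \<open>For \<open>i < 0\<close> the value is read off at \<open>n = 0\<close> from the monomial that is shifted by \<open>- i\<close>.\<close>
  define w where "w l i = (if i \<ge> 0 then a (nat i) l else a 0 (m * nat (- i) + l))" for l :: nat and i :: int
  have a_eq: "a n (m * k + l) = w l (int n - int k)" for n k l
  proof (cases "k \<le> n")
    case True
    then show ?thesis using shift_iter[of "n - k" k l]
      by (simp add: w_def nat_diff_distrib add.commute flip: of_nat_diff)
  next
    case False
    then obtain d where "k = n + d" using le_Suc_ex[of n k] by auto
    then show ?thesis using shift_iter[of 0 n "m * d + l"]
      by (cases "d = 0") (simp_all add: w_def algebra_simps)
  qed

  \<comment> \<open>Finitely supported coefficients on the integers, moved by \<open>r\<close> to make all exponents nonnegative.\<close>
  have encode: "\<exists>J c. finite J \<and> (\<Sum>j\<in>J. (cmod (c j))\<^sup>2) = coeff_energy K p q \<and>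
      (\<forall>n. (\<Sum>j\<in>J. c j * a n j) = translate_comb (w 0) (w 1) K p q (int n - int r))"
    if r: "K \<le> r" for K r p q
  proof -
    define \<iota> where "\<iota> = (\<lambda>(i, l). m * nat (i + int r) + l)"
    define I where "I = {-int K..int K} \<times> {0, 1 :: nat}"
    define c where "c j = (if j mod m = 0 then p (int (j div m) - int r) else q (int (j div m) - int r))"
      for j
    have dm: "\<iota> x div m = nat (fst x + int r)" "\<iota> x mod m = snd x" if "x \<in> I" for x
    proof -
      have "\<iota> x = snd x + m * nat (fst x + int r)" "snd x < m"
        using that m by (auto simp: \<iota>_def I_def)
      then show "\<iota> x div m = nat (fst x + int r)" "\<iota> x mod m = snd x"
        by simp_all
    qed
    have "inj_on \<iota> I"
    proof (rule inj_onI)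
      fix x y assume xy: "x \<in> I" "y \<in> I" "\<iota> x = \<iota> y"
      then have "nat (fst x + int r) = nat (fst y + int r)" "snd x = snd y"
        using dm by metis+
      moreover have "fst x + int r \<ge> 0" "fst y + int r \<ge> 0" using xy r by (auto simp: I_def)
      ultimately show "x = y" by (simp add: prod_eq_iff)
    qed
    then have "sum h (\<iota> ` I) = (\<Sum>x\<in>I. h (\<iota> x))" for h :: "nat \<Rightarrow> 'b::comm_monoid_add"
      by (simp add: sum.reindex)
    then have sum_J: "sum h (\<iota> ` I) = (\<Sum>i=-int K..int K. h (\<iota> (i, 0)) + h (\<iota> (i, 1)))"
      for h :: "nat \<Rightarrow> 'b::comm_monoid_add"
      using sum.cartesian_product[of "\<lambda>i l. h (\<iota> (i, l))" "{0, 1}" "{-int K..int K}"]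
      by (simp add: I_def case_prod_eta)
    have c: "c (\<iota> (i, 0)) = p i" "c (\<iota> (i, 1)) = q i" if "i \<in> {-int K..int K}" for i
      using that r dm[of "(i, 0)"] dm[of "(i, 1)"] by (auto simp: c_def I_def)
    have ai: "a n (\<iota> (i, l)) = w l (int n - int r - i)" if "i \<in> {-int K..int K}" for i l n
      using that r a_eq[of n "nat (i + int r)" l] by (simp add: \<iota>_def algebra_simps)
    have "(\<Sum>j\<in>\<iota> ` I. (cmod (c j))\<^sup>2) = coeff_energy K p q"
      unfolding sum_J coeff_energy_def by (rule sum.cong) (simp_all only: c)
    moreover have "(\<Sum>j\<in>\<iota> ` I. c j * a n j) = translate_comb (w 0) (w 1) K p q (int n - int r)" for n
      unfolding sum_J translate_comb_def by (rule sum.cong) (simp_all only: c ai)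
    moreover have "finite (\<iota> ` I)" by (simp add: I_def)
    ultimately show ?thesis by blast
  qed

  show ?thesis
  proof (rule translates_of_two_sequences_not_bounded_below)
    fix K M :: nat and p q
    \<comment> \<open>A delay by \<open>M\<close> makes the entries with index at least \<open>- M\<close> part of the series over \<open>n \<ge> 0\<close>.\<close>
    define r where "r = max K M"
    obtain J c where J: "finite J" "(\<Sum>j\<in>J. (cmod (c j))\<^sup>2) = coeff_energy K p q"
      "\<And>n. (\<Sum>j\<in>J. c j * a n j) = translate_comb (w 0) (w 1) K p q (int n - int r)"
      using encode[of K r p q] by (auto simp: r_def)
    have "(\<Sum>n=-int M..int M. (cmod (translate_comb (w 0) (w 1) K p q n))\<^sup>2)
        = (\<Sum>n\<in>{r - M..r + M}. (cmod (\<Sum>j\<in>J. c j * a n j))\<^sup>2)"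
      unfolding J by (rule sum.reindex_bij_witness[of _ "\<lambda>n. int n - int r" "\<lambda>i. nat (i + int r)"])
        (auto simp: r_def)
    also have "\<dots> \<le> (\<Sum>n. (cmod (\<Sum>j\<in>J. c j * a n j))\<^sup>2)"
      by (rule sum_le_suminf[OF summable[OF J(1)]]) auto
    also have "\<dots> \<le> B * coeff_energy K p q" using upper[OF J(1), of c] by (simp add: J(2))
    finally show "(\<Sum>n=-int M..int M. (cmod (translate_comb (w 0) (w 1) K p q n))\<^sup>2)
      \<le> B * coeff_energy K p q" .
  next
    fix K :: nat and p q C
    assume C: "\<And>M::nat. (\<Sum>n=-int M..int M. (cmod (translate_comb (w 0) (w 1) K p q n))\<^sup>2) \<le> C"
    obtain J c where J: "finite J" "(\<Sum>j\<in>J. (cmod (c j))\<^sup>2) = coeff_energy K p q"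
      "\<And>n. (\<Sum>j\<in>J. c j * a n j) = translate_comb (w 0) (w 1) K p q (int n - int K)"
      using encode[of K K p q] by auto
    have "(\<Sum>n. (cmod (\<Sum>j\<in>J. c j * a n j))\<^sup>2) \<le> C"
    proof (rule suminf_le_const[OF summable[OF J(1)]])
      fix N
      have "(\<Sum>n<N. (cmod (\<Sum>j\<in>J. c j * a n j))\<^sup>2)
          = (\<Sum>i\<in>(\<lambda>n. int n - int K) ` {..<N}. (cmod (translate_comb (w 0) (w 1) K p q i))\<^sup>2)"
        unfolding J by (subst sum.reindex) (auto simp: inj_on_def)
      also have "\<dots> \<le> (\<Sum>i=-int (N + K)..int (N + K). (cmod (translate_comb (w 0) (w 1) K p q i))\<^sup>2)"
        by (rule sum_mono2) auto
      finally show "(\<Sum>n<N. (cmod (\<Sum>j\<in>J. c j * a n j))\<^sup>2) \<le> C"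
        using C[of "N + K"] by linarith
    qed
    with lower[OF J(1), of c] show "A * coeff_energy K p q \<le> C"
      by (simp add: J(2))
  qed
qed

section \<open>Polynomials in the Hardy space\<close>

lemma taylor_coeff_monomial_sum:
  assumes "finite J"
  shows "taylor_coeff (\<lambda>z. \<Sum>j\<in>J. c j * z ^ j) n = (if n \<in> J then c n else 0)"
proof -
  have "(\<lambda>z. \<Sum>j\<in>J. c j * z ^ j) has_fps_expansion (\<Sum>j\<in>J. fps_const (c j) * fps_X ^ j)"
    by (intro fps_expansion_intros)
  then have "fps_expansion (\<lambda>z. \<Sum>j\<in>J. c j * z ^ j) 0 = (\<Sum>j\<in>J. fps_const (c j) * fps_X ^ j)"
    by (intro fps_expansion_eqI)
  then have "taylor_coeff (\<lambda>z. \<Sum>j\<in>J. c j * z ^ j) n = (\<Sum>j\<in>J. if n = j then c j else 0)"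
    unfolding taylor_coeff_def by (simp add: fps_sum_nth) (auto intro!: sum.cong)
  then show ?thesis using assms by simp
qed

lemma monomial_sum_sq_coeff_sums:
  assumes "finite J"
  shows "(\<lambda>n. (cmod (taylor_coeff (\<lambda>z. \<Sum>j\<in>J. c j * z ^ j) n))\<^sup>2) sums (\<Sum>j\<in>J. (cmod (c j))\<^sup>2)"
  using sums_If_finite_set[OF assms, of "\<lambda>n. (cmod (c n))\<^sup>2"]
  unfolding taylor_coeff_monomial_sum[OF assms] by (simp add: if_distrib[of cmod] if_distrib[of "\<lambda>x. x\<^sup>2"] cong: if_cong)

lemma monomial_sum_in_hardy2:
  assumes "finite J"
  shows "(\<lambda>z. \<Sum>j\<in>J. c j * z ^ j) \<in> hardy2"
  using sums_summable[OF monomial_sum_sq_coeff_sums[OF assms, of c]]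
  unfolding hardy2_def by (auto intro!: holomorphic_intros)

lemma hardy2_norm_monomial_sum:
  assumes "finite J"
  shows "(hardy2_norm (\<lambda>z. \<Sum>j\<in>J. c j * z ^ j))\<^sup>2 = (\<Sum>j\<in>J. (cmod (c j))\<^sup>2)"
  unfolding hardy2_norm_def sums_unique[OF monomial_sum_sq_coeff_sums[OF assms, of c], symmetric]
  by (simp add: sum_nonneg)

section \<open>Radial limits\<close>

lemma radius_tendsto:
  "((\<lambda>r::real. of_real r * cis \<theta>) \<longlongrightarrow> cis \<theta>) (at_left 1)"
proof -
  have "((\<lambda>r::real. of_real r * cis \<theta>) \<longlongrightarrow> of_real 1 * cis \<theta>) (at_left 1)"
    by (intro tendsto_intros)
  then show ?thesis by simp
qed

lemma isCont_imp_has_radial_limit: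
  assumes "isCont g (cis \<theta>)"
  shows "has_radial_limit g \<theta> (g (cis \<theta>))"
  unfolding has_radial_limit_def by (rule isCont_tendsto_compose[OF assms radius_tendsto])

lemma has_radial_limit_unique:
  assumes "has_radial_limit f \<theta> l" "has_radial_limit f \<theta> l'"
  shows "l = l'"
  using assms unfolding has_radial_limit_def by (rule tendsto_unique[OF trivial_limit_at_left_real])

lemma radial_value_eqI:
  assumes "has_radial_limit f \<theta> l"
  shows "radial_value f \<theta> = l"
  unfolding radial_value_def using assms has_radial_limit_unique by (intro the_equality) auto

lemma has_radial_limit_power_mult_iff:
  "has_radial_limit (\<lambda>z. z ^ k * f z) \<theta> l \<longleftrightarrow> has_radial_limit f \<theta> (l / cis \<theta> ^ k)"
proof
  assume "has_radial_limit f \<theta> (l / cis \<theta> ^ k)"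
  then have "((\<lambda>r. (of_real r * cis \<theta>) ^ k * f (of_real r * cis \<theta>))
      \<longlongrightarrow> cis \<theta> ^ k * (l / cis \<theta> ^ k)) (at_left 1)"
    unfolding has_radial_limit_def by (intro tendsto_intros radius_tendsto)
  then show "has_radial_limit (\<lambda>z. z ^ k * f z) \<theta> l"
    by (simp add: has_radial_limit_def)
next
  assume "has_radial_limit (\<lambda>z. z ^ k * f z) \<theta> l"
  then have "((\<lambda>r. (of_real r * cis \<theta>) ^ k * f (of_real r * cis \<theta>) / (of_real r * cis \<theta>) ^ k)
      \<longlongrightarrow> l / cis \<theta> ^ k) (at_left 1)"
    unfolding has_radial_limit_def by (intro tendsto_intros radius_tendsto) auto
  moreover have "\<forall>\<^sub>F r in at_left (1::real). (of_real r * cis \<theta>) ^ k * f (of_real r * cis \<theta>)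
      / (of_real r * cis \<theta>) ^ k = f (of_real r * cis \<theta>)"
    using eventually_at_left_real[OF zero_less_one] by eventually_elim auto
  ultimately show "has_radial_limit f \<theta> (l / cis \<theta> ^ k)"
    unfolding has_radial_limit_def by (rule Lim_transform_eventually)
qed

text \<open>Multiplication by a power of \<open>z\<close> does not affect the existence of radial limits. Where there is
  none, the radial value is the description of an element of the empty set, the same for all \<open>k\<close>.\<close>

lemma radial_value_power_mult:
  "radial_value (\<lambda>z. z ^ k * f z) \<theta> =
    (if \<exists>l. has_radial_limit f \<theta> l then cis \<theta> ^ k * radial_value f \<theta> else (THE l. False))"
proof (cases "\<exists>l. has_radial_limit f \<theta> l")
  case True
  then obtain l where l: "has_radial_limit f \<theta> l" by blast
  then have "has_radial_limit (\<lambda>z. z ^ k * f z) \<theta> (cis \<theta> ^ k * l)"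
    by (simp add: has_radial_limit_power_mult_iff)
  with l True show ?thesis by (simp add: radial_value_eqI)
next
  case False
  then show ?thesis by (simp add: radial_value_def has_radial_limit_power_mult_iff)
qed

text \<open>The Cauchy criterion with countable quantifiers outside and, innermost, non-strict inequalities
  between values of \<open>F\<close>. When \<open>F\<close> depends on an angle, measurability in the angle can be read off
  from this form.\<close>

lemma convergent_at_left_1_iff:
  fixes F :: "real \<Rightarrow> complex"
  shows "(\<exists>l. (F \<longlongrightarrow> l) (at_left 1)) \<longleftrightarrow>
    (\<forall>k::nat. \<exists>i::nat. \<forall>r\<in>{1 - 1 / (real i + 1)<..<1}. \<forall>s\<in>{1 - 1 / (real i + 1)<..<1}.
      dist (F r) (F s) \<le> 1 / (real k + 1))" (is "?L \<longleftrightarrow> ?R")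
proof
  assume ?L
  then obtain l where l: "(F \<longlongrightarrow> l) (at_left 1)" ..
  show ?R
  proof
    fix k :: nat
    have "\<forall>\<^sub>F r in at_left 1. dist (F r) l < 1 / (2 * (real k + 1))"
      using l by (rule tendstoD) simp
    then obtain b where b: "b < 1" "\<And>r. b < r \<Longrightarrow> r < 1 \<Longrightarrow> dist (F r) l < 1 / (2 * (real k + 1))"
      unfolding eventually_at_left[OF zero_less_one] by auto
    obtain i :: nat where "inverse (real (Suc i)) < 1 - b"
      using reals_Archimedean[of "1 - b"] b by auto
    then have i: "b < 1 - 1 / (real i + 1)" by (simp add: inverse_eq_divide add.commute)
    have "dist (F r) (F s) \<le> 1 / (real k + 1)"
      if "r \<in> {1 - 1 / (real i + 1)<..<1}" "s \<in> {1 - 1 / (real i + 1)<..<1}" for r s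
    proof -
      have "dist (F r) (F s) \<le> dist (F r) l + dist (F s) l" by (rule dist_triangle2)
      also have "\<dots> \<le> 1 / (2 * (real k + 1)) + 1 / (2 * (real k + 1))"
        using that i by (intro add_mono less_imp_le[OF b(2)]) auto
      also have "\<dots> = 1 / (real k + 1)" by (simp add: field_simps)
      finally show ?thesis .
    qed
    then show "\<exists>i::nat. \<forall>r\<in>{1 - 1 / (real i + 1)<..<1}. \<forall>s\<in>{1 - 1 / (real i + 1)<..<1}.
      dist (F r) (F s) \<le> 1 / (real k + 1)" by blast
  qed
next
  assume R: ?R
  have "cauchy_filter (filtermap F (at_left 1))"
    unfolding cauchy_filter_metric_filtermap
  proof (intro allI impI)
    fix e :: real assume "e > 0"
    then obtain k :: nat where k: "1 / (real k + 1) < e"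
      using reals_Archimedean[of e] by (auto simp: inverse_eq_divide add.commute)
    from R obtain i :: nat where i: "\<forall>r\<in>{1 - 1 / (real i + 1)<..<1}. \<forall>s\<in>{1 - 1 / (real i + 1)<..<1}.
      dist (F r) (F s) \<le> 1 / (real k + 1)" by blast
    have "\<forall>\<^sub>F r in at_left 1. r \<in> {1 - 1 / (real i + 1)<..<1}"
      by (rule eventually_at_left_real) simp
    with i k show "\<exists>P. eventually P (at_left 1) \<and> (\<forall>r s. P r \<and> P s \<longrightarrow> dist (F r) (F s) < e)"
      by (intro exI[of _ "\<lambda>r. r \<in> {1 - 1 / (real i + 1)<..<1}"]) force
  qed
  moreover have "complete (UNIV :: complex set)" by (simp add: complete_eq_closed)
  ultimately show ?L
    unfolding complete_uniform by (auto simp: filterlim_def filtermap_bot_iff)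
qed

text \<open>For fixed radii the Cauchy condition is closed in the angle, and so is its intersection over
  uncountably many radii; the set in question is thus a countable intersection of countable unions
  of closed sets.\<close>

lemma radial_limit_exists_borel:
  assumes f: "continuous_on (ball 0 1) f"
  shows "{\<theta>. \<exists>l. has_radial_limit f \<theta> l} \<in> sets borel"
proof -
  have "closed {\<theta>. dist (f (of_real r * cis \<theta>)) (f (of_real s * cis \<theta>)) \<le> e}"
    if "r \<in> {1 - 1 / (real i + 1)<..<1}" "s \<in> {1 - 1 / (real i + 1)<..<1}" for r s e and i :: nat
  proof -
    have cont: "continuous_on UNIV (\<lambda>\<theta>. f (of_real t * cis \<theta>))"
      if "t \<in> {1 - 1 / (real i + 1)<..<1}" for t
    proof (rule continuous_on_compose2[OF f])
      have "1 / (real i + 1) \<le> 1" by simp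
      then have "0 < t" "t < 1" using that unfolding greaterThanLessThan_iff by linarith+
      then show "(\<lambda>\<theta>. of_real t * cis \<theta>) ` UNIV \<subseteq> ball 0 1" by (auto simp: norm_mult)
    qed (intro continuous_intros)
    show ?thesis by (intro closed_Collect_le continuous_intros cont that)
  qed
  then have "closed (\<Inter>r\<in>{1 - 1 / (real i + 1)<..<1}. \<Inter>s\<in>{1 - 1 / (real i + 1)<..<1}.
      {\<theta>. dist (f (of_real r * cis \<theta>)) (f (of_real s * cis \<theta>)) \<le> e})" for e and i :: nat
    by (intro closed_INT ballI) blast
  then have "(\<Inter>k::nat. \<Union>i::nat. \<Inter>r\<in>{1 - 1 / (real i + 1)<..<1}. \<Inter>s\<in>{1 - 1 / (real i + 1)<..<1}.
      {\<theta>. dist (f (of_real r * cis \<theta>)) (f (of_real s * cis \<theta>)) \<le> 1 / (real k + 1)}) \<in> sets borel"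
    by (intro sets.countable_INT'' sets.countable_UN) (auto intro: borel_closed)
  also have "(\<Inter>k::nat. \<Union>i::nat. \<Inter>r\<in>{1 - 1 / (real i + 1)<..<1}. \<Inter>s\<in>{1 - 1 / (real i + 1)<..<1}.
      {\<theta>. dist (f (of_real r * cis \<theta>)) (f (of_real s * cis \<theta>)) \<le> 1 / (real k + 1)})
      = {\<theta>. \<exists>l. has_radial_limit f \<theta> l}"
    unfolding has_radial_limit_def convergent_at_left_1_iff by auto
  finally show ?thesis .
qed

section \<open>Inner products with polynomials\<close>

lemma cis_power_borel_measurable:
  "(\<lambda>\<theta>. cis \<theta> ^ k) \<in> borel_measurable (lebesgue_on {0..2 * pi})"
  by (intro continuous_imp_measurable_on_sets_lebesgue continuous_intros) auto

lemma integrable_cis_power_mult: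
  assumes "integrable (lebesgue_on {0..2 * pi}) h"
  shows "integrable (lebesgue_on {0..2 * pi}) (\<lambda>\<theta>. cis \<theta> ^ k * h \<theta>)"
  by (rule Bochner_Integration.integrable_bound[OF assms])
    (use assms cis_power_borel_measurable in \<open>auto simp: norm_mult norm_power\<close>)

lemma hardy2_inner_continuous:
  assumes "\<And>\<theta>. isCont g (cis \<theta>)"
  shows "hardy2_inner g F =
    (LINT \<theta>|lebesgue_on {0..2 * pi}. g (cis \<theta>) * cnj (radial_value F \<theta>)) / of_real (2 * pi)"
  unfolding hardy2_inner_def radial_value_eqI[OF isCont_imp_has_radial_limit[OF assms]] ..

lemma hardy2_inner_monomial_sum:
  assumes "integrable (lebesgue_on {0..2 * pi}) (radial_value F)"
  shows "hardy2_inner (\<lambda>z. \<Sum>j\<in>J. c j * z ^ j) F = (\<Sum>j\<in>J. c j * hardy2_inner (\<lambda>z. z ^ j) F)"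
proof -
  have int: "integrable (lebesgue_on {0..2 * pi}) (\<lambda>\<theta>. cis \<theta> ^ j * cnj (radial_value F \<theta>))" for j
    by (intro integrable_cis_power_mult integrable_cnj assms)
  have "(LINT \<theta>|lebesgue_on {0..2 * pi}. (\<Sum>j\<in>J. c j * cis \<theta> ^ j) * cnj (radial_value F \<theta>))
      = (LINT \<theta>|lebesgue_on {0..2 * pi}. (\<Sum>j\<in>J. c j * (cis \<theta> ^ j * cnj (radial_value F \<theta>))))"
    by (simp add: sum_distrib_right mult.assoc)
  also have "\<dots> = (\<Sum>j\<in>J. c j * (LINT \<theta>|lebesgue_on {0..2 * pi}. cis \<theta> ^ j * cnj (radial_value F \<theta>)))"
    using int by (subst Bochner_Integration.integral_sum) auto
  finally show ?thesis
    by (simp add: hardy2_inner_continuous sum_divide_distrib)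
qed

section \<open>Orbits under powers of the variable\<close>

lemma inner_function_power: "inner_function (\<lambda>z. z ^ m)"
proof -
  have "bounded ((\<lambda>z::complex. z ^ m) ` ball 0 1)"
    by (intro boundedI[where B = 1]) (auto simp: norm_power power_le_one)
  moreover have "has_radial_limit (\<lambda>z. z ^ m) \<theta> (cis \<theta> ^ m)" for \<theta>
    by (intro isCont_imp_has_radial_limit continuous_intros)
  ultimately show ?thesis
    unfolding inner_function_def hardy_inf_def
    by (auto intro!: holomorphic_intros AE_I2 exI[of _ "cis _ ^ m"] simp: norm_power)
qed

text \<open>The frame inequality is tested on polynomials only. The radial values \<open>R n\<close> of \<open>z^(m n) f\<close> equal
  \<open>cis \<theta> ^ (m n)\<close> times those of \<open>f\<close> on the set \<open>E\<close> of angles at which \<open>f\<close> has a radial limit, and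
  a constant \<open>d\<close> off \<open>E\<close>. Either none of the \<open>R n\<close> is integrable, and then all frame coefficients of
  the constant function \<open>1\<close> vanish; or all of them are, and then the frame coefficients of the
  monomials are shift invariant.\<close>

lemma z_power_orbit_not_frame:
  assumes m: "m \<ge> 2" and f: "f \<in> hardy2"
  shows "\<not> orbit_frame (\<lambda>z. z ^ m) f"
proof
  assume "orbit_frame (\<lambda>z. z ^ m) f"
  then obtain A B where A: "A > 0"
    and frame: "\<And>g. g \<in> hardy2 \<Longrightarrow>
        summable (\<lambda>n. (cmod (hardy2_inner g (\<lambda>z. (z ^ m) ^ n * f z)))\<^sup>2) \<and>
        A * (hardy2_norm g)\<^sup>2 \<le> (\<Sum>n. (cmod (hardy2_inner g (\<lambda>z. (z ^ m) ^ n * f z)))\<^sup>2) \<and>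
        (\<Sum>n. (cmod (hardy2_inner g (\<lambda>z. (z ^ m) ^ n * f z)))\<^sup>2) \<le> B * (hardy2_norm g)\<^sup>2"
    unfolding orbit_frame_def by auto
  define \<Lambda> where "\<Lambda> = lebesgue_on {0..2 * pi}"
  define R where "R n = radial_value (\<lambda>z. (z ^ m) ^ n * f z)" for n
  define a where "a n j = hardy2_inner (\<lambda>z. z ^ j) (\<lambda>z. (z ^ m) ^ n * f z)" for n j
  have a_eq: "a n j = (LINT \<theta>|\<Lambda>. cis \<theta> ^ j * cnj (R n \<theta>)) / of_real (2 * pi)" for n j
    by (simp add: a_def R_def \<Lambda>_def hardy2_inner_continuous)
  have poly: "summable (\<lambda>n. (cmod (hardy2_inner (\<lambda>z. \<Sum>j\<in>J. c j * z ^ j) (\<lambda>z. (z ^ m) ^ n * f z)))\<^sup>2) \<and>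
      A * (\<Sum>j\<in>J. (cmod (c j))\<^sup>2)
        \<le> (\<Sum>n. (cmod (hardy2_inner (\<lambda>z. \<Sum>j\<in>J. c j * z ^ j) (\<lambda>z. (z ^ m) ^ n * f z)))\<^sup>2) \<and>
      (\<Sum>n. (cmod (hardy2_inner (\<lambda>z. \<Sum>j\<in>J. c j * z ^ j) (\<lambda>z. (z ^ m) ^ n * f z)))\<^sup>2)
        \<le> B * (\<Sum>j\<in>J. (cmod (c j))\<^sup>2)" if "finite J" for J c
    using frame[OF monomial_sum_in_hardy2[OF that, of c]] hardy2_norm_monomial_sum[OF that, of c] by simp
  define E where "E = {\<theta>. \<exists>l. has_radial_limit f \<theta> l}"
  define d :: complex where "d = (THE l. False)"
  have R_eq: "R n \<theta> = (if \<theta> \<in> E then cis \<theta> ^ (m * n) * radial_value f \<theta> else d)" for n \<theta>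
    using radial_value_power_mult[of "m * n" f \<theta>] by (simp add: R_def E_def d_def power_mult)
  have "E \<in> sets borel"
    using f unfolding E_def hardy2_def
    by (intro radial_limit_exists_borel holomorphic_on_imp_continuous_on) auto
  then have E: "E \<in> sets lebesgue" by (simp add: sets_completionI_sets)
  have mult_cis: "integrable \<Lambda> (\<lambda>\<theta>. cis \<theta> ^ k * h \<theta>)" if "integrable \<Lambda> h" for k h
    using that unfolding \<Lambda>_def by (rule integrable_cis_power_mult)
  have d_int: "integrable \<Lambda> (\<lambda>\<theta>. if \<theta> \<in> E then 0 else d)"
  proof (rule Bochner_Integration.integrable_bound)
    show "integrable \<Lambda> (\<lambda>_. d)" by (simp add: \<Lambda>_def)
    show "(\<lambda>\<theta>. if \<theta> \<in> E then 0 else d) \<in> borel_measurable \<Lambda>"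
      using E unfolding \<Lambda>_def by (intro measurable_restrict_space1 measurable_If_set) auto
  qed auto
  define H where "H \<theta> = (if \<theta> \<in> E then radial_value f \<theta> else 0)" for \<theta>
  have R_split: "R n = (\<lambda>\<theta>. cis \<theta> ^ (m * n) * H \<theta> + (if \<theta> \<in> E then 0 else d))" for n
    by (auto simp: R_eq H_def)
  have R_int_iff: "integrable \<Lambda> (R n) \<longleftrightarrow> integrable \<Lambda> H" for n
  proof
    assume "integrable \<Lambda> H"
    then show "integrable \<Lambda> (R n)"
      unfolding R_split by (intro Bochner_Integration.integrable_add mult_cis d_int)
  next
    assume "integrable \<Lambda> (R n)"
    from Bochner_Integration.integrable_diff[OF this d_int]
    have "integrable \<Lambda> (\<lambda>\<theta>. cis \<theta> ^ (m * n) * H \<theta>)" by (simp add: R_split)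
    \<comment> \<open>The unimodular factor is removed by multiplying with its conjugate.\<close>
    then have "integrable \<Lambda> (\<lambda>\<theta>. cnj (cis \<theta> ^ (m * n) * cnj (cis \<theta> ^ (m * n) * H \<theta>)))"
      by (rule integrable_cnj[OF mult_cis[OF integrable_cnj]])
    moreover have "cnj (cis \<theta> ^ (m * n) * cnj (cis \<theta> ^ (m * n) * H \<theta>)) = H \<theta>" for \<theta>
      by (simp add: cis_cnj cis_mult flip: mult.assoc power_mult_distrib)
    ultimately show "integrable \<Lambda> H" by (simp only:)
  qed

  show False
  proof (cases "integrable \<Lambda> H")
    case False
    \<comment> \<open>The integral of a function that is not integrable is \<open>0\<close> by convention.\<close>
    have "a n 0 = 0" for n
      using False R_int_iff[of n] by (simp add: a_eq not_integrable_integral_eq)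
    then show False
      using poly[of "{0}" "\<lambda>_. 1"] A by (simp add: a_def)
  next
    case True
    then have R_int: "integrable \<Lambda> (R n)" for n
      using R_int_iff by blast
    have lin: "hardy2_inner (\<lambda>z. \<Sum>j\<in>J. c j * z ^ j) (\<lambda>z. (z ^ m) ^ n * f z) = (\<Sum>j\<in>J. c j * a n j)"
      for J c n
      using R_int[of n] unfolding a_def R_def \<Lambda>_def by (rule hardy2_inner_monomial_sum)
    have "a (Suc n) (j + m) = a n j" for n j
    proof -
      define \<kappa> where "\<kappa> = (LINT \<theta>|\<Lambda>. cis \<theta> ^ j * (cis \<theta> ^ m - 1) * cnj (if \<theta> \<in> E then 0 else d)) / of_real (2 * pi)"
      \<comment> \<open>On \<open>E\<close> the factors \<open>cis \<theta> ^ m\<close> cancel, so only the part off \<open>E\<close> remains, which is the same for all \<open>n\<close>.\<close>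
      have diff: "a (Suc n) (j + m) - a n j = \<kappa>" for n
      proof -
        have "cis \<theta> ^ (j + m) * cnj (R (Suc n) \<theta>) - cis \<theta> ^ j * cnj (R n \<theta>)
          = cis \<theta> ^ j * (cis \<theta> ^ m - 1) * cnj (if \<theta> \<in> E then 0 else d)" for \<theta>
        proof -
          have "cis \<theta> ^ m * cnj (cis \<theta> ^ m) = 1"
            by (simp add: cis_cnj cis_mult flip: power_mult_distrib)
          then have "cis \<theta> ^ m * (cnj (cis \<theta> ^ m) * x) = x" for x
            by (simp flip: mult.assoc)
          then show ?thesis by (simp add: R_eq power_add algebra_simps)
        qed
        moreover have "integrable \<Lambda> (\<lambda>\<theta>. cis \<theta> ^ k * cnj (R n \<theta>))" for k n
          by (intro mult_cis integrable_cnj R_int)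
        ultimately show ?thesis
          unfolding a_eq \<kappa>_def by (simp flip: diff_divide_distrib Bochner_Integration.integral_diff)
      qed
      \<comment> \<open>The frame coefficients are square-summable, so the constant difference can only be \<open>0\<close>.\<close>
      have lim: "(\<lambda>n. a n i) \<longlonglongrightarrow> 0" for i
      proof -
        have "(\<lambda>n. (cmod (a n i))\<^sup>2) \<longlonglongrightarrow> 0"
          using poly[of "{i}" "\<lambda>_. 1"] by (intro summable_LIMSEQ_zero) (simp add: a_def)
        from tendsto_real_sqrt[OF this] show ?thesis by (simp add: tendsto_norm_zero_iff)
      qed
      have "(\<lambda>n. a (Suc n) (j + m) - a n j) \<longlonglongrightarrow> 0 - 0"
        by (intro tendsto_diff lim LIMSEQ_Suc)
      then have "\<kappa> = 0" by (simp add: diff LIMSEQ_const_iff)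
      with diff[of n] show ?thesis by simp
    qed
    then have "A \<le> 0"
      by (rule shift_invariant_coefficients_not_bounded_below[OF m, where A = A and B = B])
        (use poly in \<open>simp_all add: lin\<close>)
    with A show False by simp
  qed
qed

theorem proposition2p3:
  "\<not> (\<forall>\<phi>\<in>hardy_inf. \<forall>f\<in>hardy2. inner_function \<phi> \<longrightarrow> orbit_frame \<phi> f)
   \<and> \<not> (\<forall>\<phi>\<in>hardy_inf. inner_function \<phi> \<longrightarrow> (\<exists>f\<in>hardy2. orbit_frame \<phi> f))
   \<and> (\<forall>m::nat. m \<ge> 2 \<longrightarrow>
        inner_function (\<lambda>z. z ^ m) \<and> \<not> (\<exists>f\<in>hardy2. orbit_frame (\<lambda>z. z ^ m) f))"
proof (intro conjI allI impI)
  have sq: "(\<lambda>z. z ^ 2) \<in> hardy_inf" "inner_function (\<lambda>z. z ^ 2)"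
    using inner_function_power[of 2] by (simp_all add: inner_function_def)
  \<comment> \<open>Any function in the Hardy space refutes the first claim; the empty sum is one.\<close>
  have "(\<lambda>z. \<Sum>j\<in>{}. 0 * z ^ j) \<in> hardy2" by (rule monomial_sum_in_hardy2) simp
  then show "\<not> (\<forall>\<phi>\<in>hardy_inf. \<forall>f\<in>hardy2. inner_function \<phi> \<longrightarrow> orbit_frame \<phi> f)"
    using sq z_power_orbit_not_frame[of 2] by blast
  show "\<not> (\<forall>\<phi>\<in>hardy_inf. inner_function \<phi> \<longrightarrow> (\<exists>f\<in>hardy2. orbit_frame \<phi> f))"
    using sq z_power_orbit_not_frame[of 2] by blast
qed (use inner_function_power z_power_orbit_not_frame in blast)+

end
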